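(* Let $k\ge1$ and let $\Lambda$ be a row-finite $k$-graph without sources. Let $(\mu,\nu)$ be a generalized cycle in $\Lambda$, and let $v$ be the common source of $\mu$ and $\nu$; write $v$ also for $v(0)\in T_\Lambda$. Then ${}^{d(\mu)}v\le{}^{d(\nu)}v$ in $T_\Lambda$. Furthermore, the generalized cycle $(\mu,\nu)$ has an entrance if and only if ${}^{d(\mu)}v<{}^{d(\nu)}v$.
   Context: $\mathbb{N}=\{0,1,2,\dots\}$; $\mathbb{Z}^k$ has the coordinatewise order, $\vee$ denotes coordinatewise maximum, $\mathbf{e}_i$ is the $i$-th unit vector. A $k$-graph is a countable small category $\Lambda$ with a functor $d:\Lambda\to\mathbb{N}^k$ (degree) such that whenever $d(\lambda)=\mathbf{n}+\mathbf{m}$ with $\mathbf{n},\mathbf{m}\in\mathbb{N}^k$ there are unique $\alpha,\beta\in\Lambda$ with $d(\alpha)=\mathbf{n}$, $d(\beta)=\mathbf{m}$, $\lambda=\alpha\beta$. The codomain and domain of a morphism (path) $\lambda$ are $r(\lambda)$ and $s(\lambda)$; $\lambda\mu$ is defined when $s(\lambda)=r(\mu)$. $\Lambda^{\mathbf{n}}=d^{-1}(\mathbf{n})$; elements of $\Lambda^0$ are identified with objects (vertices). $v\Lambda=\{\lambda: r(\lambda)=v\}$, $v\Lambda^{\mathbf{n}}=v\Lambda\cap\Lambda^{\mathbf{n}}$. $\Lambda$ is row-finite without sources if $0<|v\Lambda^{\mathbf{n}}|<\infty$ for all $v,\mathbf{n}$. For $0\le\mathbf{n}\le\mathbf{m}\le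 d(\lambda)$, $\lambda(\mathbf{n},\mathbf{m})$ is the unique path of degree $\mathbf{m}-\mathbf{n}$ with $\lambda=\alpha\lambda(\mathbf{n},\mathbf{m})\beta$, $d(\alpha)=\mathbf{n}$, $d(\beta)=d(\lambda)-\mathbf{m}$. For paths $\lambda,\mu$, $\mathrm{MCE}(\lambda,\mu)$ is the set of paths $\tau$ with $d(\tau)=d(\lambda)\vee d(\mu)$, $\tau(0,d(\lambda))=\lambda$ and $\tau(0,d(\mu))=\mu$. A generalized cycle is a pair $(\mu,\nu)$ of distinct paths with $s(\mu)=s(\nu)$, $r(\mu)=r(\nu)$ and $\mathrm{MCE}(\mu\tau,\nu)\ne\emptyset$ for every $\tau\in s(\mu)\Lambda$. An entrance to $(\mu,\nu)$ is a path $\tau\in s(\nu)\Lambda$ with $\mathrm{MCE}(\mu,\nu\tau)=\emptyset$. The talented monoid $T_\Lambda$ is the commutative monoid generated by symbols $v(\mathbf{n})$ ($v\in\Lambda^0$, $\mathbf{n}\in\mathbb{Z}^k$) subject to $v(\mathbf{n})=\sum_{\alpha\in v\Lambda^{\mathbf{e}_i}}s(\alpha)(\mathbf{n}+\mathbf{e}_i)$ for all $v,\mathbf{n}$ and $1\le i\le k$. $\mathbb{Z}^k$ acts by ${}^{\mathbf{q}}v(\mathbf{n})=v(\mathbf{n}+\mathbf{q})$. $x\le y$ means $y=x+z$ for some $z$; $x<y$ means $x\le y$ and $x\neq y$. *)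

theory Defs
  imports
    "HOL-Library.Multiset"
    "HOL-Library.Countable_Set"
    "HOL-Library.Function_Algebras"
    "HOL-Algebra.FiniteProduct"
begin

section \<open>k-graphs\<close>

text \<open>
  The rank is the cardinality of the finite index type \<open>'k\<close> (so it is at least 1). Elements of
  \<open>\<nat>\<^sup>k\<close> and \<open>\<int>\<^sup>k\<close> are functions \<open>'k \<Rightarrow> nat\<close> and \<open>'k \<Rightarrow> int\<close> with the pointwise operations and
  order. Composition is written in the order of paths: \<open>cmp \<Lambda> \<lambda> \<mu>\<close> is \<open>\<lambda>\<mu>\<close>, which is meaningful
  when \<open>src \<Lambda> \<lambda> = rng \<Lambda> \<mu>\<close>; here \<open>src\<close> is the domain and \<open>rng\<close> the codomain of a morphism.
\<close>

record ('v, 'p, 'k) graded_category =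
  Obj :: "'v set"
  Mor :: "'p set"
  src :: "'p \<Rightarrow> 'v"
  rng :: "'p \<Rightarrow> 'v"
  idt :: "'v \<Rightarrow> 'p"
  cmp :: "'p \<Rightarrow> 'p \<Rightarrow> 'p"
  deg :: "'p \<Rightarrow> 'k \<Rightarrow> nat"

locale small_category =
  fixes \<Lambda> :: "('v, 'p, 'k) graded_category"
  assumes src_closed: "p \<in> Mor \<Lambda> \<Longrightarrow> src \<Lambda> p \<in> Obj \<Lambda>"
    and rng_closed: "p \<in> Mor \<Lambda> \<Longrightarrow> rng \<Lambda> p \<in> Obj \<Lambda>"
    and idt_closed: "v \<in> Obj \<Lambda> \<Longrightarrow> idt \<Lambda> v \<in> Mor \<Lambda>"
    and src_idt: "v \<in> Obj \<Lambda> \<Longrightarrow> src \<Lambda> (idt \<Lambda> v) = v"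
    and rng_idt: "v \<in> Obj \<Lambda> \<Longrightarrow> rng \<Lambda> (idt \<Lambda> v) = v"
    and cmp_closed:
      "p \<in> Mor \<Lambda> \<Longrightarrow> q \<in> Mor \<Lambda> \<Longrightarrow> src \<Lambda> p = rng \<Lambda> q \<Longrightarrow> cmp \<Lambda> p q \<in> Mor \<Lambda>"
    and src_cmp:
      "p \<in> Mor \<Lambda> \<Longrightarrow> q \<in> Mor \<Lambda> \<Longrightarrow> src \<Lambda> p = rng \<Lambda> q \<Longrightarrow> src \<Lambda> (cmp \<Lambda> p q) = src \<Lambda> q"
    and rng_cmp:
      "p \<in> Mor \<Lambda> \<Longrightarrow> q \<in> Mor \<Lambda> \<Longrightarrow> src \<Lambda> p = rng \<Lambda> q \<Longrightarrow> rng \<Lambda> (cmp \<Lambda> p q) = rng \<Lambda> p"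
    and cmp_idt_left: "p \<in> Mor \<Lambda> \<Longrightarrow> cmp \<Lambda> (idt \<Lambda> (rng \<Lambda> p)) p = p"
    and cmp_idt_right: "p \<in> Mor \<Lambda> \<Longrightarrow> cmp \<Lambda> p (idt \<Lambda> (src \<Lambda> p)) = p"
    and cmp_assoc:
      "p \<in> Mor \<Lambda> \<Longrightarrow> q \<in> Mor \<Lambda> \<Longrightarrow> t \<in> Mor \<Lambda> \<Longrightarrow> src \<Lambda> p = rng \<Lambda> q \<Longrightarrow> src \<Lambda> q = rng \<Lambda> t
        \<Longrightarrow> cmp \<Lambda> (cmp \<Lambda> p q) t = cmp \<Lambda> p (cmp \<Lambda> q t)"

text \<open>
  Countability of \<open>Obj \<Lambda>\<close> follows from that of \<open>Mor \<Lambda>\<close>, since \<open>idt \<Lambda>\<close> is injective on objects.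
  By unique factorisation, \<open>idt \<Lambda>\<close> is a bijection from \<open>Obj \<Lambda>\<close> onto the morphisms of degree 0.
\<close>

locale k_graph = small_category \<Lambda>
  for \<Lambda> :: "('v, 'p, 'k::finite) graded_category" +
  assumes countable_Mor: "countable (Mor \<Lambda>)"
    and deg_idt: "v \<in> Obj \<Lambda> \<Longrightarrow> deg \<Lambda> (idt \<Lambda> v) = 0"
    and deg_cmp:
      "p \<in> Mor \<Lambda> \<Longrightarrow> q \<in> Mor \<Lambda> \<Longrightarrow> src \<Lambda> p = rng \<Lambda> q
        \<Longrightarrow> deg \<Lambda> (cmp \<Lambda> p q) = deg \<Lambda> p + deg \<Lambda> q"
    and unique_factorization:
      "l \<in> Mor \<Lambda> \<Longrightarrow> deg \<Lambda> l = n + m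
        \<Longrightarrow> \<exists>!(a, b). a \<in> Mor \<Lambda> \<and> b \<in> Mor \<Lambda> \<and> src \<Lambda> a = rng \<Lambda> b
              \<and> deg \<Lambda> a = n \<and> deg \<Lambda> b = m \<and> l = cmp \<Lambda> a b"

definition paths_from :: "('v, 'p, 'k) graded_category \<Rightarrow> 'v \<Rightarrow> 'p set" where
  "paths_from \<Lambda> v = {p \<in> Mor \<Lambda>. rng \<Lambda> p = v}"

definition paths_deg :: "('v, 'p, 'k) graded_category \<Rightarrow> 'v \<Rightarrow> ('k \<Rightarrow> nat) \<Rightarrow> 'p set" where
  "paths_deg \<Lambda> v n = {p \<in> paths_from \<Lambda> v. deg \<Lambda> p = n}"

locale row_finite_k_graph_without_sources = k_graph \<Lambda>
  for \<Lambda> :: "('v, 'p, 'k::finite) graded_category" +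
  assumes row_finite: "v \<in> Obj \<Lambda> \<Longrightarrow> finite (paths_deg \<Lambda> v n)"
    and no_sources: "v \<in> Obj \<Lambda> \<Longrightarrow> paths_deg \<Lambda> v n \<noteq> {}"

text \<open>
  \<open>segment \<Lambda> l n m\<close> is \<open>\<lambda>(n,m)\<close>; it is only meaningful for \<open>n \<le> m \<le> deg \<Lambda> l\<close>.
\<close>

definition segment ::
  "('v, 'p, 'k) graded_category \<Rightarrow> 'p \<Rightarrow> ('k \<Rightarrow> nat) \<Rightarrow> ('k \<Rightarrow> nat) \<Rightarrow> 'p" where
  "segment \<Lambda> l n m =
    (THE t. t \<in> Mor \<Lambda> \<and> deg \<Lambda> t = m - n
      \<and> (\<exists>a\<in>Mor \<Lambda>. \<exists>b\<in>Mor \<Lambda>. src \<Lambda> a = rng \<Lambda> t \<and> src \<Lambda> t = rng \<Lambda> b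
            \<and> deg \<Lambda> a = n \<and> deg \<Lambda> b = deg \<Lambda> l - m \<and> l = cmp \<Lambda> a (cmp \<Lambda> t b)))"

definition MCE :: "('v, 'p, 'k) graded_category \<Rightarrow> 'p \<Rightarrow> 'p \<Rightarrow> 'p set" where
  "MCE \<Lambda> l m =
    {t \<in> Mor \<Lambda>. deg \<Lambda> t = (\<lambda>i. max (deg \<Lambda> l i) (deg \<Lambda> m i))
      \<and> segment \<Lambda> t 0 (deg \<Lambda> l) = l \<and> segment \<Lambda> t 0 (deg \<Lambda> m) = m}"

definition generalized_cycle :: "('v, 'p, 'k) graded_category \<Rightarrow> 'p \<Rightarrow> 'p \<Rightarrow> bool" where
  "generalized_cycle \<Lambda> \<mu> \<nu> \<longleftrightarrow>
    \<mu> \<in> Mor \<Lambda> \<and> \<nu> \<in> Mor \<Lambda> \<and> \<mu> \<noteq> \<nu> \<and> src \<Lambda> \<mu> = src \<Lambda> \<nu> \<and> rng \<Lambda> \<mu> = rng \<Lambda> \<nu>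
    \<and> (\<forall>\<tau>\<in>paths_from \<Lambda> (src \<Lambda> \<mu>). MCE \<Lambda> (cmp \<Lambda> \<mu> \<tau>) \<nu> \<noteq> {})"

definition is_entrance :: "('v, 'p, 'k) graded_category \<Rightarrow> 'p \<Rightarrow> 'p \<Rightarrow> 'p \<Rightarrow> bool" where
  "is_entrance \<Lambda> \<mu> \<nu> \<tau> \<longleftrightarrow> \<tau> \<in> paths_from \<Lambda> (src \<Lambda> \<nu>) \<and> MCE \<Lambda> \<mu> (cmp \<Lambda> \<nu> \<tau>) = {}"


section \<open>The talented monoid\<close>

text \<open>
  The free commutative monoid on the symbols \<open>v(n)\<close> consists of the finite multisets of pairs
  \<open>(v, n)\<close>. The talented monoid is its quotient by the least congruence \<open>tm_cong\<close> containing the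
  defining relations; it is written multiplicatively to fit the algebra library.
\<close>

definition unit_vec :: "'k \<Rightarrow> 'k \<Rightarrow> 'a::zero_neq_one" where
  "unit_vec i = (\<lambda>j. if j = i then 1 else 0)"

definition tm_free ::
  "('v, 'p, 'k) graded_category \<Rightarrow> ('v \<times> ('k \<Rightarrow> int)) multiset set" where
  "tm_free \<Lambda> = {M. set_mset M \<subseteq> Obj \<Lambda> \<times> UNIV}"

inductive tm_cong ::
  "('v, 'p, 'k) graded_category \<Rightarrow> ('v \<times> ('k \<Rightarrow> int)) multiset
    \<Rightarrow> ('v \<times> ('k \<Rightarrow> int)) multiset \<Rightarrow> bool"
  for \<Lambda> :: "('v, 'p, 'k) graded_category" where
  relation: "v \<in> Obj \<Lambda> \<Longrightarrow>
    tm_cong \<Lambda> {#(v, n)#}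
      (image_mset (\<lambda>a. (src \<Lambda> a, n + unit_vec i)) (mset_set (paths_deg \<Lambda> v (unit_vec i))))"
| refl: "M \<in> tm_free \<Lambda> \<Longrightarrow> tm_cong \<Lambda> M M"
| sym: "tm_cong \<Lambda> M N \<Longrightarrow> tm_cong \<Lambda> N M"
| trans: "tm_cong \<Lambda> M N \<Longrightarrow> tm_cong \<Lambda> N P \<Longrightarrow> tm_cong \<Lambda> M P"
| add: "tm_cong \<Lambda> M N \<Longrightarrow> tm_cong \<Lambda> M' N' \<Longrightarrow> tm_cong \<Lambda> (M + M') (N + N')"

definition tm_rel ::
  "('v, 'p, 'k) graded_category
    \<Rightarrow> (('v \<times> ('k \<Rightarrow> int)) multiset \<times> ('v \<times> ('k \<Rightarrow> int)) multiset) set" where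
  "tm_rel \<Lambda> = {(M, N). tm_cong \<Lambda> M N}"

definition tm_class ::
  "('v, 'p, 'k) graded_category \<Rightarrow> ('v \<times> ('k \<Rightarrow> int)) multiset
    \<Rightarrow> ('v \<times> ('k \<Rightarrow> int)) multiset set" where
  "tm_class \<Lambda> M = tm_rel \<Lambda> `` {M}"

definition talented_monoid ::
  "('v, 'p, 'k) graded_category \<Rightarrow> ('v \<times> ('k \<Rightarrow> int)) multiset set monoid" where
  "talented_monoid \<Lambda> =
    \<lparr>carrier = tm_free \<Lambda> // tm_rel \<Lambda>,
     mult = (\<lambda>X Y. \<Union>M\<in>X. \<Union>N\<in>Y. tm_class \<Lambda> (M + N)),
     one = tm_class \<Lambda> {#}\<rparr>"

definition tm_vertex ::
  "('v, 'p, 'k) graded_category \<Rightarrow> 'v \<Rightarrow> ('k \<Rightarrow> int)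
    \<Rightarrow> ('v \<times> ('k \<Rightarrow> int)) multiset set" where
  "tm_vertex \<Lambda> v n = tm_class \<Lambda> {#(v, n)#}"

text \<open>
  Shifting is a bijection of the symbols that permutes the defining relations, so the image of a
  congruence class under the induced map of multisets is again a congruence class.
\<close>

definition tm_shift ::
  "('k \<Rightarrow> int) \<Rightarrow> ('v \<times> ('k \<Rightarrow> int)) multiset \<Rightarrow> ('v \<times> ('k \<Rightarrow> int)) multiset" where
  "tm_shift q = image_mset (\<lambda>(v, n). (v, n + q))"

definition tm_act ::
  "('k \<Rightarrow> int) \<Rightarrow> ('v \<times> ('k \<Rightarrow> int)) multiset set
    \<Rightarrow> ('v \<times> ('k \<Rightarrow> int)) multiset set" where
  "tm_act q X = tm_shift q ` X"

definition alg_le :: "('a, 'b) monoid_scheme \<Rightarrow> 'a \<Rightarrow> 'a \<Rightarrow> bool" where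
  "alg_le T x y \<longleftrightarrow> (\<exists>z\<in>carrier T. y = x \<otimes>\<^bsub>T\<^esub> z)"

definition alg_less :: "('a, 'b) monoid_scheme \<Rightarrow> 'a \<Rightarrow> 'a \<Rightarrow> bool" where
  "alg_less T x y \<longleftrightarrow> alg_le T x y \<and> x \<noteq> y"

definition int_vec :: "('k \<Rightarrow> nat) \<Rightarrow> 'k \<Rightarrow> int" where
  "int_vec n = (\<lambda>i. int (n i))"


section \<open>Well-definedness\<close>

context k_graph
begin

lemma factorization_inject:
  assumes "a \<in> Mor \<Lambda>" "b \<in> Mor \<Lambda>" "src \<Lambda> a = rng \<Lambda> b"
    and "a' \<in> Mor \<Lambda>" "b' \<in> Mor \<Lambda>" "src \<Lambda> a' = rng \<Lambda> b'"
    and "deg \<Lambda> a' = deg \<Lambda> a" "deg \<Lambda> b' = deg \<Lambda> b"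
    and "cmp \<Lambda> a b = cmp \<Lambda> a' b'"
  shows "a' = a \<and> b' = b"
proof -
  let ?P = "\<lambda>(x, y). x \<in> Mor \<Lambda> \<and> y \<in> Mor \<Lambda> \<and> src \<Lambda> x = rng \<Lambda> y
    \<and> deg \<Lambda> x = deg \<Lambda> a \<and> deg \<Lambda> y = deg \<Lambda> b \<and> cmp \<Lambda> a b = cmp \<Lambda> x y"
  have ex1: "\<exists>!z. ?P z"
    by (rule unique_factorization[OF cmp_closed deg_cmp]) (fact assms)+
  have P: "?P (a, b)" "?P (a', b')"
    using assms by (simp_all only: prod.case simp_thms)
  have "(a', b') = (a, b)"
    by (rule the1_equality[OF ex1 P(2), symmetric, THEN HOL.trans, OF the1_equality[OF ex1 P(1)]])
  then show ?thesis by simp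
qed

lemma segment_eqI:
  assumes t: "t \<in> Mor \<Lambda>" and a: "a \<in> Mor \<Lambda>" and b: "b \<in> Mor \<Lambda>"
    and "src \<Lambda> a = rng \<Lambda> t" "src \<Lambda> t = rng \<Lambda> b"
  shows "segment \<Lambda> (cmp \<Lambda> a (cmp \<Lambda> t b)) (deg \<Lambda> a) (deg \<Lambda> a + deg \<Lambda> t) = t"
proof -
  let ?l = "cmp \<Lambda> a (cmp \<Lambda> t b)"
  have tb: "cmp \<Lambda> t b \<in> Mor \<Lambda>" "rng \<Lambda> (cmp \<Lambda> t b) = rng \<Lambda> t"
    "deg \<Lambda> (cmp \<Lambda> t b) = deg \<Lambda> t + deg \<Lambda> b"
    using assms by (simp_all add: cmp_closed rng_cmp deg_cmp)
  have l: "?l \<in> Mor \<Lambda>" "deg \<Lambda> ?l = deg \<Lambda> a + (deg \<Lambda> t + deg \<Lambda> b)"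
    using assms tb by (simp_all add: cmp_closed deg_cmp)
  have diff: "deg \<Lambda> a + deg \<Lambda> t - deg \<Lambda> a = deg \<Lambda> t"
    "deg \<Lambda> ?l - (deg \<Lambda> a + deg \<Lambda> t) = deg \<Lambda> b"
    by (simp_all add: l(2) fun_eq_iff)
  have uniq: "t' = t" if t': "t' \<in> Mor \<Lambda>" "deg \<Lambda> t' = deg \<Lambda> t"
      and a': "a' \<in> Mor \<Lambda>" "deg \<Lambda> a' = deg \<Lambda> a" and b': "b' \<in> Mor \<Lambda>" "deg \<Lambda> b' = deg \<Lambda> b"
      and s: "src \<Lambda> a' = rng \<Lambda> t'" "src \<Lambda> t' = rng \<Lambda> b'"
      and eq: "?l = cmp \<Lambda> a' (cmp \<Lambda> t' b')" for t' a' b'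
  proof -
    have tb': "cmp \<Lambda> t' b' \<in> Mor \<Lambda>" "rng \<Lambda> (cmp \<Lambda> t' b') = rng \<Lambda> t'"
      "deg \<Lambda> (cmp \<Lambda> t' b') = deg \<Lambda> t + deg \<Lambda> b"
      using that by (simp_all add: cmp_closed rng_cmp deg_cmp)
    have src: "src \<Lambda> a = rng \<Lambda> (cmp \<Lambda> t b)" "src \<Lambda> a' = rng \<Lambda> (cmp \<Lambda> t' b')"
      by (simp_all only: tb tb' assms s)
    have "deg \<Lambda> (cmp \<Lambda> t' b') = deg \<Lambda> (cmp \<Lambda> t b)"
      by (simp only: tb tb')
    then have "cmp \<Lambda> t b = cmp \<Lambda> t' b'"
      using factorization_inject[OF a tb(1) src(1) a'(1) tb'(1) src(2) a'(2) _ eq] by simp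
    from factorization_inject[OF t b assms(5) t'(1) b'(1) s(2) t'(2) b'(2) this]
    show ?thesis by simp
  qed
  show ?thesis
    unfolding segment_def diff
  proof (rule the_equality, goal_cases)
    case 1
    show ?case
      by (intro conjI bexI[of _ a] bexI[of _ b]) (use assms in simp_all)
  next
    case (2 t')
    then show ?case by (elim conjE bexE) (rule uniq)
  qed
qed

end

context row_finite_k_graph_without_sources
begin

lemma tm_cong_free: "tm_cong \<Lambda> M N \<Longrightarrow> M \<in> tm_free \<Lambda> \<and> N \<in> tm_free \<Lambda>"
proof (induction rule: tm_cong.induct)
  case (relation v n i)
  then show ?case
    using row_finite[OF relation] src_closed
    by (auto simp: tm_free_def paths_deg_def paths_from_def)
qed (auto simp: tm_free_def)

lemma equiv_tm_rel: "equiv (tm_free \<Lambda>) (tm_rel \<Lambda>)"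
proof (rule equivI)
  show "tm_rel \<Lambda> \<subseteq> tm_free \<Lambda> \<times> tm_free \<Lambda>"
    using tm_cong_free by (auto simp: tm_rel_def)
  show "refl_on (tm_free \<Lambda>) (tm_rel \<Lambda>)"
    by (rule refl_onI) (simp add: tm_rel_def tm_cong.refl)
  show "Relation.sym (tm_rel \<Lambda>)"
    by (rule symI) (simp add: tm_rel_def tm_cong.sym)
  show "Relation.trans (tm_rel \<Lambda>)"
    by (rule transI) (simp add: tm_rel_def, rule tm_cong.trans)
qed

lemma tm_class_eq_iff:
  "M \<in> tm_free \<Lambda> \<Longrightarrow> N \<in> tm_free \<Lambda> \<Longrightarrow> tm_class \<Lambda> M = tm_class \<Lambda> N \<longleftrightarrow> tm_cong \<Lambda> M N"
  unfolding tm_class_def using eq_equiv_class_iff[OF equiv_tm_rel] by (simp add: tm_rel_def)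

lemma carrier_talented_monoid: "carrier (talented_monoid \<Lambda>) = tm_class \<Lambda> ` tm_free \<Lambda>"
  by (auto simp: talented_monoid_def tm_class_def quotient_def)

lemma mult_tm_class:
  assumes "M \<in> tm_free \<Lambda>" "N \<in> tm_free \<Lambda>"
  shows "tm_class \<Lambda> M \<otimes>\<^bsub>talented_monoid \<Lambda>\<^esub> tm_class \<Lambda> N = tm_class \<Lambda> (M + N)"
proof -
  have "tm_class \<Lambda> (M' + N') = tm_class \<Lambda> (M + N)"
    if "M' \<in> tm_class \<Lambda> M" "N' \<in> tm_class \<Lambda> N" for M' N'
  proof -
    have "tm_cong \<Lambda> (M + N) (M' + N')"
      using that by (auto simp: tm_class_def tm_rel_def intro: tm_cong.add)
    then show ?thesis using tm_class_eq_iff tm_cong_free by metis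
  qed
  note eq = this
  have "M \<in> tm_class \<Lambda> M" "N \<in> tm_class \<Lambda> N"
    using assms by (auto simp: tm_class_def tm_rel_def intro: tm_cong.refl)
  then have ne: "tm_class \<Lambda> M \<noteq> {}" "tm_class \<Lambda> N \<noteq> {}" by blast+
  have "tm_class \<Lambda> M \<otimes>\<^bsub>talented_monoid \<Lambda>\<^esub> tm_class \<Lambda> N =
      (\<Union>M'\<in>tm_class \<Lambda> M. \<Union>N'\<in>tm_class \<Lambda> N. tm_class \<Lambda> (M + N))"
    by (simp add: talented_monoid_def eq)
  then show ?thesis by (simp add: ne)
qed

lemma tm_free_empty: "{#} \<in> tm_free \<Lambda>"
  and tm_free_add: "M \<in> tm_free \<Lambda> \<Longrightarrow> N \<in> tm_free \<Lambda> \<Longrightarrow> M + N \<in> tm_free \<Lambda>"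
  by (auto simp: tm_free_def)

lemma one_talented_monoid: "\<one>\<^bsub>talented_monoid \<Lambda>\<^esub> = tm_class \<Lambda> {#}"
  by (simp add: talented_monoid_def)

lemma comm_monoid_talented_monoid: "comm_monoid (talented_monoid \<Lambda>)"
  by (rule comm_monoidI)
    (auto simp: carrier_talented_monoid mult_tm_class one_talented_monoid tm_free_empty
      tm_free_add add_ac)

lemma finprod_tm_vertex:
  assumes "finite A" and "\<And>a. a \<in> A \<Longrightarrow> f a \<in> Obj \<Lambda>"
  shows "finprod (talented_monoid \<Lambda>) (\<lambda>a. tm_vertex \<Lambda> (f a) (g a)) A =
    tm_class \<Lambda> (image_mset (\<lambda>a. (f a, g a)) (mset_set A))"
  using assms
proof (induction A rule: finite_induct)
  case empty
  interpret comm_monoid "talented_monoid \<Lambda>" by (rule comm_monoid_talented_monoid)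
  show ?case by (simp add: one_talented_monoid)
next
  case (insert x A)
  interpret comm_monoid "talented_monoid \<Lambda>" by (rule comm_monoid_talented_monoid)
  have free: "{#(f a, g a)#} \<in> tm_free \<Lambda>" if "a \<in> insert x A" for a
    using insert.prems that by (auto simp: tm_free_def)
  then have "tm_vertex \<Lambda> (f a) (g a) \<in> carrier (talented_monoid \<Lambda>)" if "a \<in> insert x A" for a
    using that by (auto simp: tm_vertex_def carrier_talented_monoid)
  then have "(\<lambda>a. tm_vertex \<Lambda> (f a) (g a)) \<in> A \<rightarrow> carrier (talented_monoid \<Lambda>)"
    "tm_vertex \<Lambda> (f x) (g x) \<in> carrier (talented_monoid \<Lambda>)" by auto
  moreover have "image_mset (\<lambda>a. (f a, g a)) (mset_set A) \<in> tm_free \<Lambda>"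
    using insert by (auto simp: tm_free_def)
  ultimately show ?case
    using insert free[of x] by (simp add: mult_tm_class tm_vertex_def[of _ "f x"])
qed

lemma tm_vertex_relation:
  assumes "v \<in> Obj \<Lambda>"
  shows "tm_vertex \<Lambda> v n =
    finprod (talented_monoid \<Lambda>) (\<lambda>a. tm_vertex \<Lambda> (src \<Lambda> a) (n + unit_vec i))
      (paths_deg \<Lambda> v (unit_vec i))"
proof -
  note rel = tm_cong.relation[OF assms, of n i]
  have "src \<Lambda> a \<in> Obj \<Lambda>" if "a \<in> paths_deg \<Lambda> v (unit_vec i)" for a
    using that by (auto simp: paths_deg_def paths_from_def src_closed)
  then show ?thesis
    using rel tm_cong_free[OF rel] row_finite[OF assms]
    by (simp add: finprod_tm_vertex tm_vertex_def[of _ v] tm_class_eq_iff)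
qed

lemma tm_cong_shift: "tm_cong \<Lambda> M N \<Longrightarrow> tm_cong \<Lambda> (tm_shift q M) (tm_shift q N)"
proof (induction rule: tm_cong.induct)
  case (relation v n i)
  then show ?case
    using tm_cong.relation[OF relation, of "n + q" i]
    by (simp add: tm_shift_def image_mset.compositionality comp_def add_ac)
next
  case (refl M)
  then show ?case
    by (intro tm_cong.refl) (auto simp: tm_free_def tm_shift_def)
next
  case (trans M N P)
  from trans.IH show ?case by (rule tm_cong.trans)
qed (simp_all add: tm_shift_def tm_cong.sym tm_cong.add)

lemma tm_act_class: "tm_act q (tm_class \<Lambda> M) = tm_class \<Lambda> (tm_shift q M)"
proof -
  have inv: "tm_shift p (tm_shift (- p) N) = N" "tm_shift (- p) (tm_shift p N) = N"
    for p and N :: "('v \<times> ('k \<Rightarrow> int)) multiset"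
    by (simp_all add: tm_shift_def image_mset.compositionality comp_def case_prod_unfold add.assoc)
  show ?thesis
  proof (intro equalityI subsetI)
    fix N assume "N \<in> tm_class \<Lambda> (tm_shift q M)"
    then have "tm_cong \<Lambda> M (tm_shift (- q) N)"
      using tm_cong_shift[of "tm_shift q M" N "- q"] by (simp add: tm_class_def tm_rel_def inv)
    then show "N \<in> tm_act q (tm_class \<Lambda> M)"
      unfolding tm_act_def tm_class_def tm_rel_def
      by (intro image_eqI[of _ _ "tm_shift (- q) N"]) (simp_all add: inv)
  qed (auto simp: tm_act_def tm_class_def tm_rel_def intro: tm_cong_shift)
qed

lemma tm_act_vertex: "tm_act q (tm_vertex \<Lambda> v n) = tm_vertex \<Lambda> v (n + q)"
  by (simp add: tm_vertex_def tm_act_class) (simp add: tm_shift_def)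

end

end

theory Submission
  imports Defs
begin

text \<open>
  Let \<open>p = d(\<mu>) \<or> d(\<nu>)\<close>, and expand \<open>v(d(\<mu>))\<close> and \<open>v(d(\<nu>))\<close> by the defining relations into sums of
  symbols \<open>w(p)\<close>, indexed by the paths from \<open>v\<close> of degree \<open>p - d(\<mu>)\<close> and \<open>p - d(\<nu>)\<close> respectively.
  As \<open>(\<mu>, \<nu>)\<close> is a generalized cycle, every \<open>\<tau>\<close> in the first set satisfies \<open>\<mu>\<tau> = \<nu>\<beta>\<close> for exactly one
  \<open>\<beta>\<close> in the second, and \<open>\<tau> \<mapsto> \<beta>\<close> is injective and preserves sources. This gives the inequality, with
  a remainder indexed by the \<open>\<beta>\<close> that are not hit; such \<open>\<beta>\<close> exist precisely when there is an entrance.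

  A nonzero remainder makes the inequality strict because \<open>x = x + z\<close> forces \<open>z = 0\<close>: congruent
  elements of the free monoid have the same expansion at every sufficiently high level, the free
  monoid is cancellative, and expanding a nonzero element never yields zero, as there are no sources.
\<close>

section \<open>Factorisations and common extensions in a k-graph\<close>

context k_graph
begin

lemma paths_from_iff: "p \<in> paths_from \<Lambda> v \<longleftrightarrow> p \<in> Mor \<Lambda> \<and> rng \<Lambda> p = v"
  by (simp add: paths_from_def)

lemma paths_deg_iff: "p \<in> paths_deg \<Lambda> v n \<longleftrightarrow> p \<in> Mor \<Lambda> \<and> rng \<Lambda> p = v \<and> deg \<Lambda> p = n"
  by (auto simp: paths_deg_def paths_from_def)

lemma factorizationE:
  assumes "l \<in> Mor \<Lambda>" "deg \<Lambda> l = n + m"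
  obtains a b where "a \<in> Mor \<Lambda>" "b \<in> Mor \<Lambda>" "src \<Lambda> a = rng \<Lambda> b"
    "deg \<Lambda> a = n" "deg \<Lambda> b = m" "l = cmp \<Lambda> a b"
  using unique_factorization[OF assms] by (auto dest!: ex1_implies_ex)

text \<open>Composing \<open>p\<close> with the identity on either side gives two factorisations of
  \<open>p\<close> into degrees 0 and 0; uniqueness identifies their first factors.\<close>

lemma deg_zero_imp_idt:
  assumes p: "p \<in> Mor \<Lambda>" "deg \<Lambda> p = 0"
  shows "p = idt \<Lambda> (rng \<Lambda> p)"
proof -
  let ?r = "idt \<Lambda> (rng \<Lambda> p)" and ?s = "idt \<Lambda> (src \<Lambda> p)"
  have "cmp \<Lambda> ?r p = cmp \<Lambda> p ?s"
    using p by (simp add: cmp_idt_left cmp_idt_right)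
  then have "p = ?r \<and> ?s = p"
    using p by (intro factorization_inject)
      (simp_all add: idt_closed rng_closed src_closed src_idt rng_idt deg_idt)
  then show ?thesis by simp
qed

lemma paths_deg_zero: "v \<in> Obj \<Lambda> \<Longrightarrow> paths_deg \<Lambda> v 0 = {idt \<Lambda> v}"
  using deg_zero_imp_idt by (auto simp: paths_deg_iff idt_closed rng_idt deg_idt)

text \<open>Unique factorisation as a bijection, ready for reindexing sums over paths of degree
  \<open>m + n\<close>.\<close>

lemma bij_betw_cmp_paths_deg:
  "bij_betw (\<lambda>(a, b). cmp \<Lambda> a b) (SIGMA a:paths_deg \<Lambda> v m. paths_deg \<Lambda> (src \<Lambda> a) n)
     (paths_deg \<Lambda> v (m + n))"
proof (intro bij_betw_imageI inj_onI equalityI subsetI)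
  fix c assume c: "c \<in> paths_deg \<Lambda> v (m + n)"
  then obtain a b where "a \<in> Mor \<Lambda>" "b \<in> Mor \<Lambda>" "src \<Lambda> a = rng \<Lambda> b"
    "deg \<Lambda> a = m" "deg \<Lambda> b = n" "c = cmp \<Lambda> a b"
    using factorizationE[of c m n] by (auto simp: paths_deg_iff)
  with c show "c \<in> (\<lambda>(a, b). cmp \<Lambda> a b) `
      (SIGMA a:paths_deg \<Lambda> v m. paths_deg \<Lambda> (src \<Lambda> a) n)"
    by (intro image_eqI[of _ _ "(a, b)"]) (auto simp: paths_deg_iff rng_cmp)
next
  fix x y
  assume "x \<in> (SIGMA a:paths_deg \<Lambda> v m. paths_deg \<Lambda> (src \<Lambda> a) n)"
    "y \<in> (SIGMA a:paths_deg \<Lambda> v m. paths_deg \<Lambda> (src \<Lambda> a) n)"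
    "(case x of (a, b) \<Rightarrow> cmp \<Lambda> a b) = (case y of (a, b) \<Rightarrow> cmp \<Lambda> a b)"
  then show "x = y"
    using factorization_inject[of "fst x" "snd x" "fst y" "snd y"]
    by (auto simp: paths_deg_iff)
qed (auto simp: paths_deg_iff cmp_closed rng_cmp deg_cmp)

lemma cmp_left_cancel:
  assumes "p \<in> Mor \<Lambda>" "a \<in> paths_deg \<Lambda> (src \<Lambda> p) n" "b \<in> paths_deg \<Lambda> (src \<Lambda> p) n"
    and "cmp \<Lambda> p a = cmp \<Lambda> p b"
  shows "a = b"
proof -
  have "a \<in> Mor \<Lambda>" "src \<Lambda> p = rng \<Lambda> a" "b \<in> Mor \<Lambda>" "src \<Lambda> p = rng \<Lambda> b" "deg \<Lambda> b = deg \<Lambda> a"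
    using assms(2,3) by (simp_all add: paths_deg_iff)
  from factorization_inject[OF assms(1) this(1,2) assms(1) this(3,4) HOL.refl this(5) assms(4)]
  show ?thesis by simp
qed

text \<open>Take the path preceding the middle segment to be the identity at the range of
  \<open>a\<close>.\<close>

lemma segment_cmp:
  assumes "a \<in> Mor \<Lambda>" "b \<in> Mor \<Lambda>" "src \<Lambda> a = rng \<Lambda> b"
  shows "segment \<Lambda> (cmp \<Lambda> a b) 0 (deg \<Lambda> a) = a"
  using segment_eqI[of a "idt \<Lambda> (rng \<Lambda> a)" b] assms cmp_idt_left[of "cmp \<Lambda> a b"]
  by (simp add: rng_closed idt_closed src_idt deg_idt cmp_closed rng_cmp)

lemma segment_eq_prefixE:
  assumes t: "t \<in> Mor \<Lambda>" "deg \<Lambda> l \<le> deg \<Lambda> t" and seg: "segment \<Lambda> t 0 (deg \<Lambda> l) = l"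
  obtains c where "c \<in> paths_deg \<Lambda> (src \<Lambda> l) (deg \<Lambda> t - deg \<Lambda> l)" "t = cmp \<Lambda> l c"
proof -
  have "deg \<Lambda> t = deg \<Lambda> l + (deg \<Lambda> t - deg \<Lambda> l)"
    using t(2) by (auto simp: le_fun_def fun_eq_iff)
  from factorizationE[OF t(1) this] obtain a b where ab: "a \<in> Mor \<Lambda>" "b \<in> Mor \<Lambda>"
    "src \<Lambda> a = rng \<Lambda> b" "deg \<Lambda> a = deg \<Lambda> l" "deg \<Lambda> b = deg \<Lambda> t - deg \<Lambda> l" "t = cmp \<Lambda> a b"
    by metis
  then have "a = l" using segment_cmp[of a b] seg by simp
  with ab show ?thesis by (intro that[of b]) (auto simp: paths_deg_iff)
qed

text \<open>Trades the segments in \<open>MCE\<close> for an explicit commuting square, the form in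
  which the later arguments use minimal common extensions.\<close>

lemma MCE_nonemptyE:
  assumes "MCE \<Lambda> l m \<noteq> {}"
  obtains c d where "c \<in> paths_deg \<Lambda> (src \<Lambda> l) (sup (deg \<Lambda> l) (deg \<Lambda> m) - deg \<Lambda> l)"
    "d \<in> paths_deg \<Lambda> (src \<Lambda> m) (sup (deg \<Lambda> l) (deg \<Lambda> m) - deg \<Lambda> m)"
    "cmp \<Lambda> l c = cmp \<Lambda> m d"
proof -
  from assms obtain t where t: "t \<in> Mor \<Lambda>" "deg \<Lambda> t = sup (deg \<Lambda> l) (deg \<Lambda> m)"
    "segment \<Lambda> t 0 (deg \<Lambda> l) = l" "segment \<Lambda> t 0 (deg \<Lambda> m) = m"
    by (auto simp: MCE_def sup_fun_def sup_max)
  obtain c where c: "c \<in> paths_deg \<Lambda> (src \<Lambda> l) (deg \<Lambda> t - deg \<Lambda> l)" "t = cmp \<Lambda> l c"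
    using segment_eq_prefixE[of t l] t by auto
  obtain d where d: "d \<in> paths_deg \<Lambda> (src \<Lambda> m) (deg \<Lambda> t - deg \<Lambda> m)" "t = cmp \<Lambda> m d"
    using segment_eq_prefixE[of t m] t by auto
  show ?thesis using c d t(2) by (intro that[of c d]) auto
qed

text \<open>Split \<open>t\<close> as \<open>a b\<close> with \<open>a\<close> of the degree of
  \<open>l\<close>. Then \<open>l c = a (b e)\<close>, where the first factors, hence also the
  second ones, have equal degrees, so \<open>a = l\<close>.\<close>

lemma segment_prefix:
  assumes "l \<in> Mor \<Lambda>" "c \<in> Mor \<Lambda>" "src \<Lambda> l = rng \<Lambda> c"
    and "t \<in> Mor \<Lambda>" "e \<in> Mor \<Lambda>" "src \<Lambda> t = rng \<Lambda> e"
    and eq: "cmp \<Lambda> l c = cmp \<Lambda> t e" and le: "deg \<Lambda> l \<le> deg \<Lambda> t"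
  shows "segment \<Lambda> t 0 (deg \<Lambda> l) = l"
proof -
  have "deg \<Lambda> t = deg \<Lambda> l + (deg \<Lambda> t - deg \<Lambda> l)"
    using le by (auto simp: le_fun_def fun_eq_iff)
  from factorizationE[OF \<open>t \<in> Mor \<Lambda>\<close> this] obtain a b where ab: "a \<in> Mor \<Lambda>" "b \<in> Mor \<Lambda>"
    "src \<Lambda> a = rng \<Lambda> b" "deg \<Lambda> a = deg \<Lambda> l" "t = cmp \<Lambda> a b"
    by metis
  have be: "src \<Lambda> b = rng \<Lambda> e" using ab assms by (simp add: src_cmp)
  then have eq': "cmp \<Lambda> l c = cmp \<Lambda> a (cmp \<Lambda> b e)"
    using ab assms by (simp add: cmp_assoc)
  have "deg \<Lambda> l + deg \<Lambda> c = deg \<Lambda> a + deg \<Lambda> (cmp \<Lambda> b e)"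
    using arg_cong[OF eq', of "deg \<Lambda>"] ab(1-4) assms(1-3,5) be
    by (simp add: deg_cmp cmp_closed rng_cmp)
  then have "deg \<Lambda> (cmp \<Lambda> b e) = deg \<Lambda> c" unfolding ab(4) by simp
  moreover have "cmp \<Lambda> b e \<in> Mor \<Lambda>" "src \<Lambda> a = rng \<Lambda> (cmp \<Lambda> b e)"
    using ab(1-3) assms(5) be by (simp_all add: cmp_closed rng_cmp)
  ultimately have "a = l"
    using factorization_inject[OF assms(1-3) ab(1) _ _ ab(4) _ eq'] by simp
  then show ?thesis using segment_cmp[of a b] ab by simp
qed

text \<open>Any common extension suffices: its initial segment of degree
  \<open>sup (deg \<Lambda> l) (deg \<Lambda> m)\<close> is a minimal one.\<close>

lemma MCE_nonemptyI:
  assumes l: "l \<in> Mor \<Lambda>" "c \<in> paths_from \<Lambda> (src \<Lambda> l)"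
    and m: "m \<in> Mor \<Lambda>" "d \<in> paths_from \<Lambda> (src \<Lambda> m)"
    and eq: "cmp \<Lambda> l c = cmp \<Lambda> m d"
  shows "MCE \<Lambda> l m \<noteq> {}"
proof -
  let ?x = "cmp \<Lambda> l c" and ?n = "sup (deg \<Lambda> l) (deg \<Lambda> m)"
  have x: "?x \<in> Mor \<Lambda>" using l by (simp add: paths_from_iff cmp_closed)
  have "deg \<Lambda> ?x = deg \<Lambda> l + deg \<Lambda> c" using l by (simp add: paths_from_iff deg_cmp)
  moreover have "deg \<Lambda> ?x = deg \<Lambda> m + deg \<Lambda> d" unfolding eq using m
    by (simp add: paths_from_iff deg_cmp)
  ultimately have "deg \<Lambda> l \<le> deg \<Lambda> ?x" "deg \<Lambda> m \<le> deg \<Lambda> ?x"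
    by (metis le_funI le_add1 plus_fun_apply)+
  then have "?n \<le> deg \<Lambda> ?x" by (rule le_supI)
  then have "deg \<Lambda> ?x = ?n + (deg \<Lambda> ?x - ?n)" by (simp add: fun_eq_iff le_fun_def)
  from factorizationE[OF x this] obtain t e where t: "t \<in> Mor \<Lambda>" "e \<in> Mor \<Lambda>"
    "src \<Lambda> t = rng \<Lambda> e" "deg \<Lambda> t = ?n" "?x = cmp \<Lambda> t e"
    by metis
  have "segment \<Lambda> t 0 (deg \<Lambda> l) = l"
    using segment_prefix[of l c t e] l t by (simp add: paths_from_iff)
  moreover have "segment \<Lambda> t 0 (deg \<Lambda> m) = m"
    using segment_prefix[of m d t e] m t eq by (simp add: paths_from_iff)
  ultimately have "t \<in> MCE \<Lambda> l m"
    using t by (simp add: MCE_def sup_fun_def sup_max)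
  then show ?thesis by blast
qed

end

section \<open>Expanding symbols of the talented monoid along paths\<close>

context row_finite_k_graph_without_sources
begin

lemma finite_paths_deg: "finite (paths_deg \<Lambda> v n)"
proof (cases "v \<in> Obj \<Lambda>")
  case False
  then have "paths_deg \<Lambda> v n = {}" using rng_closed by (auto simp: paths_deg_iff)
  then show ?thesis by simp
qed (rule row_finite)

lemma sum_paths_deg_add:
  fixes f :: "'p \<Rightarrow> 'a::comm_monoid_add"
  shows "(\<Sum>c\<in>paths_deg \<Lambda> v (m + n). f c) =
    (\<Sum>a\<in>paths_deg \<Lambda> v m. \<Sum>b\<in>paths_deg \<Lambda> (src \<Lambda> a) n. f (cmp \<Lambda> a b))"
  by (simp add: sum.Sigma finite_paths_deg case_prod_unfold
      sum.reindex_bij_betw[OF bij_betw_cmp_paths_deg, symmetric])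

lemma sum_src_paths_deg_add:
  fixes g :: "'v \<Rightarrow> 'a::comm_monoid_add"
  shows "(\<Sum>c\<in>paths_deg \<Lambda> v (m + n). g (src \<Lambda> c)) =
    (\<Sum>a\<in>paths_deg \<Lambda> v m. \<Sum>b\<in>paths_deg \<Lambda> (src \<Lambda> a) n. g (src \<Lambda> b))"
  unfolding sum_paths_deg_add by (auto simp: paths_deg_iff src_cmp intro!: sum.cong)

lemma image_mset_mset_set: "finite A \<Longrightarrow> image_mset f (mset_set A) = (\<Sum>x\<in>A. {#f x#})"
  by (induction A rule: finite_induct) auto

lemma tm_cong_sum:
  assumes "finite A" "\<And>a. a \<in> A \<Longrightarrow> tm_cong \<Lambda> (f a) (g a)"
  shows "tm_cong \<Lambda> (\<Sum>a\<in>A. f a) (\<Sum>a\<in>A. g a)"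
  using assms
  by (induction A rule: finite_induct) (auto intro: tm_cong.refl tm_cong.add tm_free_empty)

lemma sum_vertices_free:
  "A \<subseteq> Mor \<Lambda> \<Longrightarrow> finite A \<Longrightarrow> (\<Sum>a\<in>A. {#(src \<Lambda> a, n)#}) \<in> tm_free \<Lambda>"
  by (auto simp: tm_free_def src_closed image_mset_mset_set[symmetric])

declare tm_cong.trans [trans]

text \<open>Induction on the total degree of \<open>p\<close>: peel off one edge by a defining
  relation, then expand each of its sources by the remaining degree.\<close>

lemma tm_cong_expand_vertex:
  assumes "v \<in> Obj \<Lambda>"
  shows "tm_cong \<Lambda> {#(v, n)#} (\<Sum>a\<in>paths_deg \<Lambda> v p. {#(src \<Lambda> a, n + int_vec p)#})"
  using assms
proof (induction "\<Sum>i\<in>UNIV. p i" arbitrary: p v n)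
  case 0
  then have "p = 0" by (simp add: fun_eq_iff)
  moreover have "int_vec (0 :: 'k \<Rightarrow> nat) = 0" by (simp add: int_vec_def fun_eq_iff)
  ultimately show ?case
    using "0.prems" tm_cong.refl[of "{#(v, n)#}" \<Lambda>]
    by (simp only: paths_deg_zero) (simp add: src_idt tm_free_def)
next
  case (Suc N)
  have "(\<Sum>i\<in>UNIV. p i) \<noteq> 0" using Suc.hyps(2) by linarith
  then obtain i where i: "p i > 0" by auto
  define q where "q = p - unit_vec i"
  have p: "p = unit_vec i + q"
    using i by (auto simp: q_def unit_vec_def fun_eq_iff)
  have ivp: "int_vec p = unit_vec i + int_vec q"
    unfolding p by (auto simp: int_vec_def unit_vec_def fun_eq_iff)
  have "(\<Sum>j\<in>UNIV. p j) = Suc (\<Sum>j\<in>UNIV. q j)"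
    unfolding p by (simp add: sum.distrib unit_vec_def)
  then have N: "N = (\<Sum>j\<in>UNIV. q j)" using Suc.hyps(2) by simp
  have "tm_cong \<Lambda> {#(v, n)#} (\<Sum>a\<in>paths_deg \<Lambda> v (unit_vec i). {#(src \<Lambda> a, n + unit_vec i)#})"
    using tm_cong.relation[OF Suc.prems, of n i]
    by (simp add: image_mset_mset_set finite_paths_deg)
  also have "tm_cong \<Lambda> \<dots> (\<Sum>a\<in>paths_deg \<Lambda> v (unit_vec i). \<Sum>b\<in>paths_deg \<Lambda> (src \<Lambda> a) q.
      {#(src \<Lambda> b, n + unit_vec i + int_vec q)#})"
    by (intro tm_cong_sum finite_paths_deg Suc.hyps(1) N) (simp add: paths_deg_iff src_closed)
  \<comment> \<open>Unique factorisation merges edge and remainder into paths of degree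
    \<open>p\<close>.\<close>
  also have "\<dots> = (\<Sum>c\<in>paths_deg \<Lambda> v p. {#(src \<Lambda> c, n + int_vec p)#})"
    unfolding ivp by (subst p) (simp add: sum_src_paths_deg_add[of "\<lambda>w. {#(w, _)#}"] add.assoc)
  finally show ?case .
qed

section \<open>Expansions as invariants of the congruence\<close>

text \<open>
  The sources of the paths that expand \<open>M\<close> to level \<open>q\<close>; meaningful only when \<open>q\<close> is an upper bound of
  the levels in \<open>M\<close>, since \<open>nat\<close> truncates.
\<close>

definition expand :: "('k \<Rightarrow> int) \<Rightarrow> ('v \<times> ('k \<Rightarrow> int)) multiset \<Rightarrow> 'v multiset" where
  "expand q M =
    (\<Sum>(v, n)\<in>#M. \<Sum>a\<in>paths_deg \<Lambda> v (\<lambda>i. nat (q i - n i)). {#src \<Lambda> a#})"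

lemma expand_empty: "expand q {#} = {#}"
  and expand_single:
    "expand q {#(v, n)#} = (\<Sum>a\<in>paths_deg \<Lambda> v (\<lambda>i. nat (q i - n i)). {#src \<Lambda> a#})"
  and expand_add: "expand q (M + N) = expand q M + expand q N"
  by (simp_all add: expand_def)

lemma expand_sum: "expand q (\<Sum>a\<in>A. f a) = (\<Sum>a\<in>A. expand q (f a))"
  by (induction A rule: infinite_finite_induct) (simp_all add: expand_empty expand_add)

text \<open>As there are no sources, a symbol \<open>(v, n)\<close> contributes at least one path at
  every \<open>q\<close>, truncated or not.\<close>

lemma expand_eq_empty_imp:
  assumes "M \<in> tm_free \<Lambda>" "expand q M = {#}"
  shows "M = {#}"
proof (rule ccontr)
  assume "M \<noteq> {#}"
  then obtain v n N where M: "M = {#(v, n)#} + N"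
    by (metis multiset_cases add_mset_add_single add.commute surj_pair)
  then have "v \<in> Obj \<Lambda>" using assms by (auto simp: tm_free_def)
  then have "paths_deg \<Lambda> v (\<lambda>i. nat (q i - n i)) \<noteq> {}" by (rule no_sources)
  then have "expand q {#(v, n)#} \<noteq> {#}"
    by (simp add: expand_single image_mset_mset_set[symmetric] mset_set_empty_iff finite_paths_deg)
  then show False using assms(2) unfolding M expand_add by simp
qed

text \<open>Each congruence rule preserves equality of expansions from some level on. Transitivity
  and addition each combine two thresholds, for which the join serves.\<close>

lemma tm_cong_imp_expand_eq:
  assumes "tm_cong \<Lambda> M N"
  shows "\<exists>q0. \<forall>q\<ge>q0. expand q M = expand q N"
  using assms
proof (induction rule: tm_cong.induct)
  case (relation v n i)
  have "expand q {#(v, n)#} = expand q (image_mset (\<lambda>a. (src \<Lambda> a, n + unit_vec i))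
      (mset_set (paths_deg \<Lambda> v (unit_vec i))))" if q: "q \<ge> n + unit_vec i" for q
  proof -
    \<comment> \<open>The paths counted on the left split into an edge of degree
      \<open>unit_vec i\<close> and a rest. The bound on \<open>q\<close> matters at coordinate
      \<open>i\<close>: for \<open>q i \<le> n i\<close> truncation would give 0 on the left and 1
      on the right.\<close>
    have "(\<lambda>j. nat (q j - n j)) = unit_vec i + (\<lambda>j. nat (q j - (n + unit_vec i) j))"
    proof
      fix j
      have "n j + unit_vec i j \<le> q j" using q by (simp add: le_fun_def)
      then show "nat (q j - n j) = (unit_vec i + (\<lambda>j. nat (q j - (n + unit_vec i) j))) j"
        by (cases "j = i") (simp_all add: unit_vec_def)
    qed
    then show ?thesis
      by (simp add: image_mset_mset_set finite_paths_deg expand_sum expand_single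
          sum_src_paths_deg_add[of "\<lambda>w. {#w#}"])
  qed
  then show ?case by blast
next
  case (trans M N P)
  then obtain q1 q2 where "\<forall>q\<ge>q1. expand q M = expand q N" "\<forall>q\<ge>q2. expand q N = expand q P"
    by blast
  then show ?case by (intro exI[of _ "sup q1 q2"]) (metis le_supE)
next
  case (add M N M' N')
  then obtain q1 q2 where "\<forall>q\<ge>q1. expand q M = expand q N" "\<forall>q\<ge>q2. expand q M' = expand q N'"
    by blast
  then show ?case by (intro exI[of _ "sup q1 q2"]) (metis expand_add le_supE)
qed metis+

lemma tm_cong_add_self_imp_empty:
  assumes "tm_cong \<Lambda> M (M + Z)"
  shows "Z = {#}"
proof -
  obtain q where "expand q M = expand q (M + Z)"
    using tm_cong_imp_expand_eq[OF assms] by blast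
  then have "expand q Z = {#}" by (simp add: expand_add)
  moreover have "Z \<in> tm_free \<Lambda>" using tm_cong_free[OF assms] by (auto simp: tm_free_def)
  ultimately show ?thesis by (rule expand_eq_empty_imp[rotated])
qed

section \<open>Unhit paths, entrances and the remainder\<close>

text \<open>The degree of \<open>a\<close> is left free because the equation determines it: it must
  be \<open>sup (deg \<Lambda> \<mu>) (deg \<Lambda> \<nu>) - deg \<Lambda> \<mu>\<close>.\<close>

definition unhit :: "'p \<Rightarrow> 'p \<Rightarrow> 'p set" where
  "unhit \<mu> \<nu> = {b \<in> paths_deg \<Lambda> (src \<Lambda> \<nu>) (sup (deg \<Lambda> \<mu>) (deg \<Lambda> \<nu>) - deg \<Lambda> \<nu>).
     \<nexists>a. a \<in> paths_from \<Lambda> (src \<Lambda> \<mu>) \<and> cmp \<Lambda> \<mu> a = cmp \<Lambda> \<nu> b}"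

text \<open>An entrance, once extended far enough, has an unhit initial segment; conversely, an
  unhit path is itself an entrance.\<close>

lemma entrance_iff_unhit:
  assumes \<mu>: "\<mu> \<in> Mor \<Lambda>" and \<nu>: "\<nu> \<in> Mor \<Lambda>"
  shows "(\<exists>\<tau>. is_entrance \<Lambda> \<mu> \<nu> \<tau>) \<longleftrightarrow> unhit \<mu> \<nu> \<noteq> {}"
proof
  let ?k = "sup (deg \<Lambda> \<mu>) (deg \<Lambda> \<nu>) - deg \<Lambda> \<nu>"
  assume "\<exists>\<tau>. is_entrance \<Lambda> \<mu> \<nu> \<tau>"
  then obtain \<tau> where \<tau>: "\<tau> \<in> Mor \<Lambda>" "rng \<Lambda> \<tau> = src \<Lambda> \<nu>"
    and MCE: "MCE \<Lambda> \<mu> (cmp \<Lambda> \<nu> \<tau>) = {}"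
    by (auto simp: is_entrance_def paths_from_iff)
  \<comment> \<open>\<open>\<tau>\<close> may be too short to have an initial segment of degree
    \<open>?k\<close>; appending a path \<open>g\<close> of that degree, which exists as there are
    no sources, makes one available.\<close>
  obtain g where g: "g \<in> Mor \<Lambda>" "rng \<Lambda> g = src \<Lambda> \<tau>" "deg \<Lambda> g = ?k"
    using no_sources[of "src \<Lambda> \<tau>" ?k] \<tau> by (auto simp: paths_deg_iff src_closed)
  have "cmp \<Lambda> \<tau> g \<in> Mor \<Lambda>" "deg \<Lambda> (cmp \<Lambda> \<tau> g) = ?k + deg \<Lambda> \<tau>"
    using \<tau> g by (simp_all add: cmp_closed deg_cmp add.commute)
  from factorizationE[OF this] obtain b e where b: "b \<in> Mor \<Lambda>" "e \<in> Mor \<Lambda>"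
    "src \<Lambda> b = rng \<Lambda> e" "deg \<Lambda> b = ?k" "cmp \<Lambda> \<tau> g = cmp \<Lambda> b e"
    by metis
  have rb: "rng \<Lambda> b = src \<Lambda> \<nu>"
    using arg_cong[OF b(5), of "rng \<Lambda>"] b(1-3) \<tau> g by (simp add: rng_cmp)
  \<comment> \<open>If \<open>b\<close> were hit by \<open>a\<close>, then
    \<open>\<mu> a e = \<nu> b e = \<nu> \<tau> g\<close> would be a common extension of
    \<open>\<mu>\<close> and \<open>\<nu> \<tau>\<close>.\<close>
  have False if a: "a \<in> Mor \<Lambda>" "rng \<Lambda> a = src \<Lambda> \<mu>" "cmp \<Lambda> \<mu> a = cmp \<Lambda> \<nu> b" for a
  proof -
    have sa: "src \<Lambda> a = rng \<Lambda> e"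
      using arg_cong[OF a(3), of "src \<Lambda>"] a(1,2) b(1-3) rb \<mu> \<nu> by (simp add: src_cmp)
    have "cmp \<Lambda> \<mu> (cmp \<Lambda> a e) = cmp \<Lambda> (cmp \<Lambda> \<mu> a) e"
      using \<mu> a(1,2) b(1-3) sa by (simp add: cmp_assoc)
    also have "\<dots> = cmp \<Lambda> \<nu> (cmp \<Lambda> b e)"
      unfolding a(3) using \<nu> b rb by (simp add: cmp_assoc)
    also have "\<dots> = cmp \<Lambda> (cmp \<Lambda> \<nu> \<tau>) g"
      using \<nu> \<tau> g b(5) by (simp add: cmp_assoc)
    finally have "MCE \<Lambda> \<mu> (cmp \<Lambda> \<nu> \<tau>) \<noteq> {}"
      using \<mu> \<nu> \<tau> g a b sa
      by (intro MCE_nonemptyI[of \<mu> "cmp \<Lambda> a e" _ g])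
        (simp_all add: paths_from_iff cmp_closed rng_cmp src_cmp)
    then show False using MCE by simp
  qed
  then have "b \<in> unhit \<mu> \<nu>"
    using b rb by (auto simp: unhit_def paths_deg_iff paths_from_iff)
  then show "unhit \<mu> \<nu> \<noteq> {}" by blast
next
  let ?n = "sup (deg \<Lambda> \<mu>) (deg \<Lambda> \<nu>)"
  assume "unhit \<mu> \<nu> \<noteq> {}"
  then obtain b where b: "b \<in> Mor \<Lambda>" "rng \<Lambda> b = src \<Lambda> \<nu>" "deg \<Lambda> b = ?n - deg \<Lambda> \<nu>"
    and no: "\<And>a. a \<in> paths_from \<Lambda> (src \<Lambda> \<mu>) \<Longrightarrow> cmp \<Lambda> \<mu> a \<noteq> cmp \<Lambda> \<nu> b"
    by (auto simp: unhit_def paths_deg_iff)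
  have \<nu>b: "cmp \<Lambda> \<nu> b \<in> Mor \<Lambda>" using b \<nu> by (simp add: cmp_closed)
  have deg: "deg \<Lambda> (cmp \<Lambda> \<nu> b) = ?n"
    using b \<nu> by (auto simp: deg_cmp fun_eq_iff sup_fun_def)
  \<comment> \<open>\<open>\<nu> b\<close> already has degree \<open>?n\<close>, so a minimal common
    extension can only be \<open>\<nu> b\<close> itself, and then \<open>\<mu> c = \<nu> b\<close>
    for some \<open>c\<close>, which hits \<open>b\<close>.\<close>
  have "MCE \<Lambda> \<mu> (cmp \<Lambda> \<nu> b) = {}"
  proof (rule ccontr)
    assume "MCE \<Lambda> \<mu> (cmp \<Lambda> \<nu> b) \<noteq> {}"
    then obtain c d where c: "c \<in> Mor \<Lambda>" "rng \<Lambda> c = src \<Lambda> \<mu>"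
      and d: "d \<in> paths_deg \<Lambda> (src \<Lambda> (cmp \<Lambda> \<nu> b)) (sup (deg \<Lambda> \<mu>) ?n - ?n)"
      and eq: "cmp \<Lambda> \<mu> c = cmp \<Lambda> (cmp \<Lambda> \<nu> b) d"
      using deg by (auto elim!: MCE_nonemptyE simp: paths_deg_iff)
    have "sup (deg \<Lambda> \<mu>) ?n - ?n = 0" by (simp add: fun_eq_iff)
    with d have "d = idt \<Lambda> (src \<Lambda> (cmp \<Lambda> \<nu> b))"
      using paths_deg_zero[OF src_closed[OF \<nu>b]] by simp
    then have "cmp \<Lambda> \<mu> c = cmp \<Lambda> \<nu> b" using eq \<nu>b by (simp add: cmp_idt_right)
    then show False using no c by (simp add: paths_from_iff)
  qed
  then show "\<exists>\<tau>. is_entrance \<Lambda> \<mu> \<nu> \<tau>"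
    using b by (auto simp: is_entrance_def paths_from_iff)
qed

text \<open>The equation \<open>\<mu> a = \<nu> b\<close> forces equal sources, which is why the
  summand may depend on a path only through its source.\<close>

lemma sum_generalized_cycle:
  fixes g :: "'v \<Rightarrow> 'a::comm_monoid_add"
  assumes gc: "generalized_cycle \<Lambda> \<mu> \<nu>"
  defines "n \<equiv> sup (deg \<Lambda> \<mu>) (deg \<Lambda> \<nu>)"
  shows "(\<Sum>b\<in>paths_deg \<Lambda> (src \<Lambda> \<nu>) (n - deg \<Lambda> \<nu>). g (src \<Lambda> b)) =
    (\<Sum>a\<in>paths_deg \<Lambda> (src \<Lambda> \<mu>) (n - deg \<Lambda> \<mu>). g (src \<Lambda> a)) + (\<Sum>b\<in>unhit \<mu> \<nu>. g (src \<Lambda> b))"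
proof -
  let ?A = "paths_deg \<Lambda> (src \<Lambda> \<mu>) (n - deg \<Lambda> \<mu>)" and ?B = "paths_deg \<Lambda> (src \<Lambda> \<nu>) (n - deg \<Lambda> \<nu>)"
  have \<mu>: "\<mu> \<in> Mor \<Lambda>" and \<nu>: "\<nu> \<in> Mor \<Lambda>"
    and MCE: "\<And>\<tau>. \<tau> \<in> paths_from \<Lambda> (src \<Lambda> \<mu>) \<Longrightarrow> MCE \<Lambda> (cmp \<Lambda> \<mu> \<tau>) \<nu> \<noteq> {}"
    using gc by (auto simp: generalized_cycle_def)
  have n: "deg \<Lambda> \<mu> + (n - deg \<Lambda> \<mu>) = n" "deg \<Lambda> \<nu> + (n - deg \<Lambda> \<nu>) = n"
    by (auto simp: n_def fun_eq_iff sup_fun_def)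
  \<comment> \<open>\<open>\<mu> a\<close> has degree \<open>n\<close>, which already dominates that
    of \<open>\<nu>\<close>; a minimal common extension of \<open>\<mu> a\<close> and
    \<open>\<nu>\<close> is therefore \<open>\<mu> a\<close> itself.\<close>
  have "\<exists>b\<in>?B. cmp \<Lambda> \<mu> a = cmp \<Lambda> \<nu> b" if a: "a \<in> ?A" for a
  proof -
    have \<mu>a: "cmp \<Lambda> \<mu> a \<in> Mor \<Lambda>" and deg: "deg \<Lambda> (cmp \<Lambda> \<mu> a) = n"
      using a \<mu> n by (simp_all add: paths_deg_iff cmp_closed deg_cmp)
    have "sup n (deg \<Lambda> \<nu>) = n" by (simp add: n_def)
    with deg MCE[of a] a obtain c d where cd: "c \<in> paths_deg \<Lambda> (src \<Lambda> (cmp \<Lambda> \<mu> a)) (n - n)"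
      "d \<in> ?B" "cmp \<Lambda> (cmp \<Lambda> \<mu> a) c = cmp \<Lambda> \<nu> d"
      by (auto elim!: MCE_nonemptyE simp: paths_deg_iff paths_from_iff)
    then have "c = idt \<Lambda> (src \<Lambda> (cmp \<Lambda> \<mu> a))"
      using paths_deg_zero[OF src_closed[OF \<mu>a]] by (simp add: zero_fun_def fun_diff_def)
    then show ?thesis using cd \<mu>a by (auto simp: cmp_idt_right)
  qed
  then obtain f where f: "\<And>a. a \<in> ?A \<Longrightarrow> f a \<in> ?B"
    "\<And>a. a \<in> ?A \<Longrightarrow> cmp \<Lambda> \<mu> a = cmp \<Lambda> \<nu> (f a)"
    by metis
  have src: "src \<Lambda> a = src \<Lambda> (f a)" if "a \<in> ?A" for a
    using arg_cong[OF f(2)[OF that], of "src \<Lambda>"] f(1)[OF that] that \<mu> \<nu>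
    by (simp add: src_cmp paths_deg_iff)
  have "inj_on f ?A"
  proof (rule inj_onI)
    fix a a' assume a: "a \<in> ?A" "a' \<in> ?A" "f a = f a'"
    have "cmp \<Lambda> \<mu> a = cmp \<Lambda> \<mu> a'" using f(2)[OF a(1)] f(2)[OF a(2)] a(3) by simp
    then show "a = a'" by (rule cmp_left_cancel[OF \<mu> a(1,2)])
  qed
  moreover have "f ` ?A = ?B - unhit \<mu> \<nu>"
  proof (intro equalityI subsetI)
    fix b assume b: "b \<in> ?B - unhit \<mu> \<nu>"
    then obtain a where a: "a \<in> Mor \<Lambda>" "rng \<Lambda> a = src \<Lambda> \<mu>" "cmp \<Lambda> \<mu> a = cmp \<Lambda> \<nu> b"
      by (auto simp: unhit_def paths_from_iff n_def)
    \<comment> \<open>Being hit only provides some path \<open>a\<close>; comparing degrees places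
      it in \<open>?A\<close>.\<close>
    have "deg \<Lambda> \<mu> + deg \<Lambda> a = n"
      using arg_cong[OF a(3), of "deg \<Lambda>"] a(1,2) b \<mu> \<nu> n by (simp add: deg_cmp paths_deg_iff)
    then have "deg \<Lambda> \<mu> + deg \<Lambda> a = deg \<Lambda> \<mu> + (n - deg \<Lambda> \<mu>)" using n by simp
    then have aA: "a \<in> ?A" using a(1,2) unfolding add_left_cancel by (simp add: paths_deg_iff)
    \<comment> \<open>\<open>\<nu>\<close> cancels on the left, so \<open>b\<close> is the value
      chosen by \<open>f\<close>.\<close>
    have "cmp \<Lambda> \<nu> b = cmp \<Lambda> \<nu> (f a)" using a(3) f(2)[OF aA] by simp
    then have "b = f a" using b by (intro cmp_left_cancel[OF \<nu> _ f(1)[OF aA]]) auto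
    with aA show "b \<in> f ` ?A" by blast
  next
    fix b assume "b \<in> f ` ?A"
    then obtain a where "a \<in> ?A" "b = f a" by blast
    then show "b \<in> ?B - unhit \<mu> \<nu>"
      using f[of a] by (auto simp: unhit_def paths_deg_iff paths_from_iff)
  qed
  ultimately have "bij_betw f ?A (?B - unhit \<mu> \<nu>)" by (simp add: bij_betw_def)
  then have "(\<Sum>b\<in>?B - unhit \<mu> \<nu>. g (src \<Lambda> b)) = (\<Sum>a\<in>?A. g (src \<Lambda> (f a)))"
    by (rule sum.reindex_bij_betw[symmetric])
  also have "\<dots> = (\<Sum>a\<in>?A. g (src \<Lambda> a))"
    by (rule sum.cong[OF HOL.refl]) (simp only: src)
  finally have hit: "(\<Sum>b\<in>?B - unhit \<mu> \<nu>. g (src \<Lambda> b)) = (\<Sum>a\<in>?A. g (src \<Lambda> a))" .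
  have "unhit \<mu> \<nu> \<subseteq> ?B" by (auto simp: unhit_def n_def)
  from sum.subset_diff[OF this finite_paths_deg, of "\<lambda>b. g (src \<Lambda> b)"] show ?thesis
    unfolding hit .
qed

text \<open>Expand the symbol at level \<open>deg \<Lambda> \<nu>\<close> up to \<open>n\<close>,
  split off the unhit paths as the remainder \<open>Z\<close>, and contract the hit part, rewritten
  over \<open>\<mu>\<close>, back to a single symbol.\<close>

lemma tm_vertex_generalized_cycle:
  assumes gc: "generalized_cycle \<Lambda> \<mu> \<nu>"
  defines "v \<equiv> src \<Lambda> \<mu>"
  obtains Z where "Z \<in> tm_free \<Lambda>" "Z = {#} \<longleftrightarrow> unhit \<mu> \<nu> = {}"
    "tm_cong \<Lambda> {#(v, int_vec (deg \<Lambda> \<nu>))#} ({#(v, int_vec (deg \<Lambda> \<mu>))#} + Z)"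
proof -
  define n where "n = sup (deg \<Lambda> \<mu>) (deg \<Lambda> \<nu>)"
  have \<mu>: "\<mu> \<in> Mor \<Lambda>" and \<nu>: "\<nu> \<in> Mor \<Lambda>" and s: "src \<Lambda> \<nu> = v"
    using gc by (auto simp: generalized_cycle_def v_def)
  have v: "v \<in> Obj \<Lambda>" unfolding v_def using \<mu> by (rule src_closed)
  \<comment> \<open>\<open>n\<close> dominates both degrees, so truncated subtraction is exact
    here.\<close>
  have n: "int_vec (deg \<Lambda> \<mu>) + int_vec (n - deg \<Lambda> \<mu>) = int_vec n"
    "int_vec (deg \<Lambda> \<nu>) + int_vec (n - deg \<Lambda> \<nu>) = int_vec n"
    by (auto simp: n_def fun_eq_iff sup_fun_def int_vec_def)
  let ?Z = "\<Sum>b\<in>unhit \<mu> \<nu>. {#(src \<Lambda> b, int_vec n)#}"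
  have unhit: "unhit \<mu> \<nu> \<subseteq> Mor \<Lambda>" "finite (unhit \<mu> \<nu>)"
    by (auto simp: unhit_def paths_deg_iff intro: finite_subset[OF _ finite_paths_deg])
  have Z: "?Z \<in> tm_free \<Lambda>" by (rule sum_vertices_free[OF unhit])
  have Z_empty: "?Z = {#} \<longleftrightarrow> unhit \<mu> \<nu> = {}"
    using unhit(2) by (simp add: image_mset_mset_set[symmetric] mset_set_empty_iff)
  have "tm_cong \<Lambda> {#(v, int_vec (deg \<Lambda> \<nu>))#}
      (\<Sum>b\<in>paths_deg \<Lambda> v (n - deg \<Lambda> \<nu>). {#(src \<Lambda> b, int_vec n)#})"
    using tm_cong_expand_vertex[OF v, of "int_vec (deg \<Lambda> \<nu>)" "n - deg \<Lambda> \<nu>"] by (simp only: n)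
  also have "\<dots> = (\<Sum>a\<in>paths_deg \<Lambda> v (n - deg \<Lambda> \<mu>). {#(src \<Lambda> a, int_vec n)#}) + ?Z"
    using sum_generalized_cycle[OF gc, of "\<lambda>w. {#(w, int_vec n)#}"]
    by (simp add: n_def[symmetric] s v_def[symmetric])
  also have "tm_cong \<Lambda> \<dots> ({#(v, int_vec (deg \<Lambda> \<mu>))#} + ?Z)"
    using tm_cong_expand_vertex[OF v, of "int_vec (deg \<Lambda> \<mu>)" "n - deg \<Lambda> \<mu>"]
    by (intro tm_cong.add[OF tm_cong.sym tm_cong.refl[OF Z]]) (simp only: n)
  finally show ?thesis
    by (rule that[OF Z Z_empty])
qed

end

section \<open>Transfer to the algebraic order of the talented monoid\<close>

theorem lemma4p2p5:
  fixes \<Lambda> :: "('v, 'p, 'k::finite) graded_category"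
    and \<mu> \<nu> :: 'p and v :: 'v
  assumes "row_finite_k_graph_without_sources \<Lambda>"
    and "generalized_cycle \<Lambda> \<mu> \<nu>"
    and "v = src \<Lambda> \<mu>" and "v = src \<Lambda> \<nu>"
  shows "alg_le (talented_monoid \<Lambda>)
           (tm_act (int_vec (deg \<Lambda> \<mu>)) (tm_vertex \<Lambda> v 0))
           (tm_act (int_vec (deg \<Lambda> \<nu>)) (tm_vertex \<Lambda> v 0))
    \<and> ((\<exists>\<tau>. is_entrance \<Lambda> \<mu> \<nu> \<tau>) \<longleftrightarrow>
         alg_less (talented_monoid \<Lambda>)
           (tm_act (int_vec (deg \<Lambda> \<mu>)) (tm_vertex \<Lambda> v 0))
           (tm_act (int_vec (deg \<Lambda> \<nu>)) (tm_vertex \<Lambda> v 0)))"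
proof -
  interpret row_finite_k_graph_without_sources \<Lambda> by (fact assms(1))
  let ?x = "{#(v, int_vec (deg \<Lambda> \<mu>))#}" and ?y = "{#(v, int_vec (deg \<Lambda> \<nu>))#}"
  have \<mu>: "\<mu> \<in> Mor \<Lambda>" and \<nu>: "\<nu> \<in> Mor \<Lambda>"
    using assms(2) by (auto simp: generalized_cycle_def)
  obtain Z where Z: "Z \<in> tm_free \<Lambda>" "Z = {#} \<longleftrightarrow> unhit \<mu> \<nu> = {}" "tm_cong \<Lambda> ?y (?x + Z)"
    using tm_vertex_generalized_cycle[OF assms(2)] assms(3) by metis
  have free: "?x \<in> tm_free \<Lambda>" "?y \<in> tm_free \<Lambda>" "?x + Z \<in> tm_free \<Lambda>"
    using Z(1) src_closed[OF \<mu>] assms(3) by (auto simp: tm_free_def)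
  have act: "tm_act (int_vec m) (tm_vertex \<Lambda> v 0) = tm_class \<Lambda> {#(v, int_vec m)#}" for m
    by (simp add: tm_act_vertex) (simp add: tm_vertex_def)
  have "tm_class \<Lambda> ?y = tm_class \<Lambda> ?x \<otimes>\<^bsub>talented_monoid \<Lambda>\<^esub> tm_class \<Lambda> Z"
    using Z free by (simp add: mult_tm_class tm_class_eq_iff)
  then have le: "alg_le (talented_monoid \<Lambda>) (tm_class \<Lambda> ?x) (tm_class \<Lambda> ?y)"
    using Z(1) by (auto simp: alg_le_def carrier_talented_monoid)
  \<comment> \<open>Since \<open>?y\<close> is congruent to \<open>?x + Z\<close>, equality of the
    classes means that \<open>?x\<close> absorbs \<open>Z\<close>, which forces \<open>Z\<close> to
    be empty.\<close>
  have "tm_class \<Lambda> ?x = tm_class \<Lambda> ?y \<longleftrightarrow> tm_cong \<Lambda> ?x (?x + Z)"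
    using tm_class_eq_iff[OF free(1,2)] tm_cong.trans[OF _ Z(3), of ?x]
      tm_cong.trans[OF _ tm_cong.sym[OF Z(3)], of ?x] by blast
  also have "\<dots> \<longleftrightarrow> Z = {#}"
    using tm_cong_add_self_imp_empty[of ?x Z] tm_cong.refl[OF free(1)] by auto
  finally have "tm_class \<Lambda> ?x \<noteq> tm_class \<Lambda> ?y \<longleftrightarrow> (\<exists>\<tau>. is_entrance \<Lambda> \<mu> \<nu> \<tau>)"
    using Z(2) entrance_iff_unhit[OF \<mu> \<nu>] by simp
  with le show ?thesis unfolding act alg_less_def by blast
qed

end
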